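(* Let $\Omega$ be an exterior domain and $\varepsilon>0$ as in the context, and let $\bar{\boldsymbol u}:\Omega\to\mathbb{R}^2$ be a (measurable) vector field. If for some $\delta>0$ $$\sup_{\boldsymbol x\in\Omega}\Big(|\boldsymbol x|\log(\varepsilon^{-1}|\boldsymbol x|)\,|\bar{\boldsymbol u}(\boldsymbol x)|\Big)\le\frac\delta2,$$ then for all $\boldsymbol v\in\dot H^1_{0,\sigma}(\Omega)$, $$\big|\big(\boldsymbol v\cdot\nabla\boldsymbol v,\bar{\boldsymbol u}\big)\big|\le\delta\,\|\nabla\boldsymbol v\|_2^2 .$$
   Context: Domain: $\Omega=\mathbb{R}^2\setminus\bar B$, where $B$ is a bounded simply connected Lipschitz domain with $\boldsymbol 0\in B$; $\varepsilon>0$ is fixed such that $B(\boldsymbol 0,\varepsilon)\cap\Omega=\emptyset$, where $B(\boldsymbol 0,\varepsilon)$ is the open ball of radius $\varepsilon$ centered at the origin. $\dot H^1_{0,\sigma}(\Omega)$ is the completion, in the natural norm of $\dot H^1(\Omega)$, of the space $C^\infty_{0,\sigma}(\Omega)$ of smooth divergence-free vector fields with compact support in $\Omega$. $(\cdot,\cdot)$ is the $L^2(\Omega)$ pairing, so $(\boldsymbol v\cdot\nabla\boldsymbol v,\bar{\boldsymbol u})=\int_\Omega\sum_{i,j}v_i(\partial_iv_j)\bar u_j$, and $\|\cdot\|_2$ is the $L^2(\Omega)$ norm. *)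

theory Defs
  imports "HOL-Analysis.Analysis"
begin

(* The graph function f is globally Lipschitz; only its values near the
   coordinates of the boundary point p matter, since U may be small. *)
definition lipschitz_domain :: "(real^2) set \<Rightarrow> bool" where
  "lipschitz_domain B \<longleftrightarrow>
     open B \<and> connected B \<and> B \<noteq> {} \<and>
     (\<forall>p\<in>frontier B. \<exists>U (T :: real^2 \<Rightarrow> real^2) (f :: real \<Rightarrow> real) L.
        open U \<and> p \<in> U \<and> orthogonal_transformation T \<and> L-lipschitz_on UNIV f \<and>
        B \<inter> U = {x \<in> U. f (T (x - p) $ 1) < T (x - p) $ 2})"

definition partial :: "2 \<Rightarrow> (real^2 \<Rightarrow> 'b::real_normed_vector) \<Rightarrow> real^2 \<Rightarrow> 'b" where
  "partial i f x = frechet_derivative f (at x) (axis i 1)"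

primrec Ck :: "nat \<Rightarrow> (real^2 \<Rightarrow> 'b::real_normed_vector) \<Rightarrow> bool" where
  "Ck 0 f \<longleftrightarrow> continuous_on UNIV f"
| "Ck (Suc k) f \<longleftrightarrow> (\<forall>x. f differentiable (at x)) \<and> (\<forall>i. Ck k (partial i f))"

(* Elements of C_0^infty(S), extended by zero to the whole plane. *)
definition test_functions :: "(real^2) set \<Rightarrow> (real^2 \<Rightarrow> 'b::real_normed_vector) set" where
  "test_functions S =
     {\<phi>. (\<forall>k. Ck k \<phi>) \<and> compact (closure {x. \<phi> x \<noteq> 0}) \<and> closure {x. \<phi> x \<noteq> 0} \<subseteq> S}"

definition divergence :: "(real^2 \<Rightarrow> real^2) \<Rightarrow> real^2 \<Rightarrow> real" where
  "divergence \<phi> x = (\<Sum>i\<in>UNIV. partial i \<phi> x $ i)"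

definition solenoidal_test_fields :: "(real^2) set \<Rightarrow> (real^2 \<Rightarrow> real^2) set" where
  "solenoidal_test_fields S = {\<phi> \<in> test_functions S. \<forall>x. divergence \<phi> x = 0}"

(* Gradients of vector fields are matrices with (i,j) entry the i-th partial derivative
   of the j-th component.  The norm of the type real^2^2 is the Frobenius norm. *)
definition gradient :: "(real^2 \<Rightarrow> real^2) \<Rightarrow> real^2 \<Rightarrow> real^2^2" where
  "gradient \<phi> x = (\<chi> i j. partial i \<phi> x $ j)"

definition L2 :: "(real^2) set \<Rightarrow> (real^2 \<Rightarrow> 'b::euclidean_space) set" where
  "L2 S = {f \<in> borel_measurable (lebesgue_on S). integrable (lebesgue_on S) (\<lambda>x. (norm (f x))\<^sup>2)}"

definition L2_norm :: "(real^2) set \<Rightarrow> (real^2 \<Rightarrow> 'b::euclidean_space) \<Rightarrow> real" where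
  "L2_norm S f = sqrt (\<integral>x. (norm (f x))\<^sup>2 \<partial>lebesgue_on S)"

definition locally_L1 :: "(real^2) set \<Rightarrow> (real^2 \<Rightarrow> 'b::euclidean_space) set" where
  "locally_L1 S = {f \<in> borel_measurable (lebesgue_on S).
     \<forall>K. compact K \<and> K \<subseteq> S \<longrightarrow> integrable (lebesgue_on K) f}"

definition has_weak_gradient ::
  "(real^2) set \<Rightarrow> (real^2 \<Rightarrow> real^2) \<Rightarrow> (real^2 \<Rightarrow> real^2^2) \<Rightarrow> bool" where
  "has_weak_gradient S v G \<longleftrightarrow>
     v \<in> locally_L1 S \<and> G \<in> locally_L1 S \<and>
     (\<forall>\<phi>\<in>test_functions S. \<forall>i j.
        (\<integral>x. v x $ j * partial i \<phi> x \<partial>lebesgue_on S) =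
        - (\<integral>x. G x $ i $ j * \<phi> x \<partial>lebesgue_on S))"

(* Unique up to null sets in S; every use below is insensitive to the representative. *)
definition weak_gradient ::
  "(real^2) set \<Rightarrow> (real^2 \<Rightarrow> real^2) \<Rightarrow> real^2 \<Rightarrow> real^2^2" where
  "weak_gradient S v = (SOME G. has_weak_gradient S v G)"

(* The completion of the solenoidal test fields on S under the norm L2_norm S (gradient _),
   realised as a space of functions.  By the Poincare (Hardy) inequality, in an exterior
   Lipschitz domain a sequence of test fields that is Cauchy in this norm is Cauchy in
   L2 on each compact subset of S, so each element of the completion is given by a unique
   (up to null sets) limit function v, and the limit of the gradients is the weak gradient
   of v.  Convergence of the gradients alone would fix v only up to an additive constant. *)
definition H1dot_0_sigma :: "(real^2) set \<Rightarrow> (real^2 \<Rightarrow> real^2) set" where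
  "H1dot_0_sigma S = {v.
     (\<exists>G. has_weak_gradient S v G) \<and> weak_gradient S v \<in> L2 S \<and>
     (\<forall>K. compact K \<and> K \<subseteq> S \<longrightarrow> v \<in> L2 K) \<and>
     (\<exists>\<phi>. (\<forall>n::nat. \<phi> n \<in> solenoidal_test_fields S) \<and>
        (\<lambda>n. L2_norm S (\<lambda>x. gradient (\<phi> n) x - weak_gradient S v x)) \<longlonglongrightarrow> 0 \<and>
        (\<forall>K. compact K \<and> K \<subseteq> S \<longrightarrow> (\<lambda>n. L2_norm K (\<lambda>x. \<phi> n x - v x)) \<longlonglongrightarrow> 0))}"

definition convection_density ::
  "(real^2) set \<Rightarrow> (real^2 \<Rightarrow> real^2) \<Rightarrow> (real^2 \<Rightarrow> real^2) \<Rightarrow> real^2 \<Rightarrow> real" where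
  "convection_density S v u x =
     (\<Sum>i\<in>UNIV. \<Sum>j\<in>UNIV. v x $ i * weak_gradient S v x $ i $ j * u x $ j)"

end

(* Let w(x) = 1 / (|x| ln (|x|/eps)).  The field F(x) = x / (|x|^2 ln (|x|/eps)) has |F| = w and
   div F = - w^2, so integrating div (|phi|^2 F) over the plane gives, for a test field phi supported
   in Omega, the Hardy inequality |w phi|_2 <= 2 |grad phi|_2.  It passes to the completion by
   taking limits on compact subsets, where w is bounded.  Since |u| <= (delta/2) w, Cauchy-Schwarz
   bounds the trilinear form by (delta/2) |w v|_2 |grad v|_2. *)
theory Submission
  imports Defs
begin

text \<open>The logarithm is forced by dimension two. Away from the origin x/|x|^2 is divergence
  free in the plane, so this field gives no Hardy inequality with weight 1/|x|. Dividing it by L =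
  ln (|x|/eps) leaves a single term in the divergence, grad (1/L) . x/|x|^2 = - 1/(|x|^2 L^2). The
  field F is singular at the origin and on the circle |x| = eps, but the compact support of a test
  field stays away from both, so |phi|^2 F is differentiable on the whole plane. The boundary of
  Omega may touch that circle, so w can be unbounded on Omega, while the approximating fields
  converge to v only on compact subsets. The bound on each compact subset therefore has to come with
  a constant that does not depend on the subset, and monotone convergence then extends it to Omega.
  This also settles that the trilinear integrand is integrable, which is not clear beforehand
  because v need not be square integrable on Omega.\<close>

section \<open>Derivatives of compactly supported functions integrate to zero\<close>

lemma lborel_integral_translate:
  fixes g :: "'a::euclidean_space \<Rightarrow> real"
  assumes [measurable]: "g \<in> borel_measurable borel"
  shows "(\<integral>x. g (x + c) \<partial>lborel) = (\<integral>x. g x \<partial>lborel)"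
proof -
  have "(\<integral>x. g x \<partial>lborel) = (\<integral>x. g x \<partial>distr lborel borel ((+) c))"
    by (simp add: lborel_distr_plus)
  also have "\<dots> = (\<integral>x. g (c + x) \<partial>lborel)"
    by (rule integral_distr) auto
  finally show ?thesis
    by (simp add: add.commute)
qed

text \<open>Continuity is asked only on \<open>K\<close>, because the lemma is applied to products
  with the Hardy weight, which is singular elsewhere in the plane.\<close>

lemma integrable_continuous_compact_support:
  fixes f :: "'a::euclidean_space \<Rightarrow> 'b::{banach, second_countable_topology}"
  assumes "compact K" "continuous_on K f" "\<And>x. x \<notin> K \<Longrightarrow> f x = 0"
  shows "integrable lborel f"
proof -
  have "integrable lborel (\<lambda>x. indicator K x *\<^sub>R f x)"
    using assms by (intro borel_integrable_compact) auto
  also have "(\<lambda>x. indicator K x *\<^sub>R f x) = f"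
    using assms(3) by (force simp: indicator_def)
  finally show ?thesis .
qed

(* The difference quotients of g integrate to 0 by translation invariance and are dominated. *)
lemma integral_directional_derivative_eq_0:
  fixes g :: "'a::euclidean_space \<Rightarrow> real"
  assumes der: "\<And>x. (g has_derivative g' x) (at x)"
    and C: "\<And>x. \<bar>g' x e\<bar> \<le> C"
    and S: "bounded S" "\<And>x. x \<notin> S \<Longrightarrow> g x = 0"
  shows "integrable lborel (\<lambda>x. g' x e)" "(\<integral>x. g' x e \<partial>lborel) = 0"
proof -
  obtain R where R: "S \<subseteq> cball 0 R"
    using S(1) by (auto simp: bounded_iff subset_iff)
  have cont: "continuous_on A g" for A
    by (intro continuous_at_imp_continuous_on ballI has_derivative_continuous[OF der])
  have g_meas [measurable]: "g \<in> borel_measurable borel"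
    by (intro borel_measurable_continuous_onI cont)
  have g_int: "integrable lborel g"
    using R S(2) by (intro integrable_continuous_compact_support[OF compact_cball cont]) blast
  define s where "s n = inverse (real (Suc n))" for n
  have s: "0 < s n" "s n \<le> 1" for n
    by (auto simp: s_def field_simps)
  define f where "f n x = (g (x + s n *\<^sub>R e) - g x) / s n" for n x
  \<comment> \<open>Step lengths are at most 1, so the difference quotients vanish outside the ball
    of radius \<open>R\<close> enlarged by \<open>norm e\<close>. Inside it the mean value theorem
    bounds them by \<open>C\<close>.\<close>
  define w where "w x = indicat_real (cball 0 (R + norm e)) x * C" for x :: 'a
  have line: "((\<lambda>t. g (x + t *\<^sub>R e)) has_real_derivative g' (x + t *\<^sub>R e) e) (at t)" for x t
  proof -
    have "((\<lambda>t. g (x + t *\<^sub>R e)) has_derivative (\<lambda>h. g' (x + t *\<^sub>R e) (h *\<^sub>R e))) (at t)"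
      by (rule has_derivative_compose[OF _ der]) (auto intro!: derivative_eq_intros)
    then show ?thesis
      by (simp add: has_field_derivative_def mult_commute_abs
          linear_cmul[OF has_derivative_linear[OF der]])
  qed
  have lim: "(\<lambda>n. f n x) \<longlonglongrightarrow> g' x e" for x
  proof -
    have "((\<lambda>h. (g (x + h *\<^sub>R e) - g x) / h) \<longlongrightarrow> g' x e) (at 0)"
      using line[of x 0] by (simp add: DERIV_def)
    moreover have "filterlim s (at 0) sequentially"
      unfolding filterlim_at s_def using LIMSEQ_inverse_real_of_nat by auto
    ultimately show ?thesis
      unfolding f_def by (rule filterlim_compose)
  qed
  have bound: "\<bar>f n x\<bar> \<le> w x" for n x
  proof (cases "x \<in> cball 0 (R + norm e)")
    case True
    obtain z where "g (x + s n *\<^sub>R e) - g x = s n * g' (x + z *\<^sub>R e) e"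
      using MVT2[of 0 "s n" "\<lambda>t. g (x + t *\<^sub>R e)", OF s(1) line] by auto
    then show ?thesis
      using True C s(1)[of n] by (simp add: f_def w_def)
  next
    case False
    have "norm (s n *\<^sub>R e) \<le> norm e"
      using s[of n] by (simp add: mult_left_le_one_le)
    moreover have "R + norm e < norm x" "norm x \<le> norm (x + s n *\<^sub>R e) + norm (s n *\<^sub>R e)"
      using False norm_triangle_ineq4[of "x + s n *\<^sub>R e" "s n *\<^sub>R e"] by simp_all
    ultimately have "R < norm x" "R < norm (x + s n *\<^sub>R e)"
      using norm_ge_zero[of e] by linarith+
    then have "x \<notin> S" "x + s n *\<^sub>R e \<notin> S"
      using R by auto
    then show ?thesis
      using False S(2) by (simp add: f_def w_def)
  qed
  have w_int: "integrable lborel w"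
    unfolding w_def by (intro integrable_mult_left integrable_real_indicator)
      (use emeasure_bounded_finite[OF bounded_cball] in auto)
  have meas: "f n \<in> borel_measurable lborel" for n
    unfolding f_def by measurable
  \<comment> \<open>Continuity of the derivative is not assumed; measurability comes from its being
    a pointwise limit of the quotients.\<close>
  have meas': "(\<lambda>x. g' x e) \<in> borel_measurable lborel"
    by (rule borel_measurable_LIMSEQ_metric[OF meas lim])
  have int0: "integral\<^sup>L lborel (f n) = 0" for n
  proof -
    have "integrable lborel (\<lambda>x. g (x + s n *\<^sub>R e))"
    proof -
      have "integrable (distr lborel borel ((+) (s n *\<^sub>R e))) g"
        using g_int by (simp add: lborel_distr_plus)
      then show ?thesis
        by (subst (asm) integrable_distr_eq) (auto simp: add.commute)
    qed
    then show ?thesis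
      unfolding f_def using g_int by (simp add: lborel_integral_translate)
  qed
  note dc = meas' meas w_int AE_I2[OF lim] AE_I2[of lborel, OF bound[folded real_norm_def]]
  show "integrable lborel (\<lambda>x. g' x e)"
    by (rule integrable_dominated_convergence[OF dc])
  have "(\<lambda>n. integral\<^sup>L lborel (f n)) \<longlonglongrightarrow> (\<integral>x. g' x e \<partial>lborel)"
    by (rule integral_dominated_convergence[OF dc])
  then show "(\<integral>x. g' x e \<partial>lborel) = 0"
    by (simp add: int0 LIMSEQ_const_iff)
qed

section \<open>Cauchy-Schwarz and triangle inequality for the L2 norm\<close>

lemma L2_norm_nonneg: "0 \<le> L2_norm S f"
  by (simp add: L2_norm_def)

lemma L2_norm_square: "(L2_norm S f)\<^sup>2 = (\<integral>x. (norm (f x))\<^sup>2 \<partial>lebesgue_on S)"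
  by (simp add: L2_norm_def)

lemma integrable_L2_product:
  assumes "f \<in> L2 S" "g \<in> L2 S"
  shows "integrable (lebesgue_on S) (\<lambda>x. norm (f x) * norm (g x))"
proof (rule Bochner_Integration.integrable_bound)
  show "integrable (lebesgue_on S) (\<lambda>x. (norm (f x))\<^sup>2 + (norm (g x))\<^sup>2)"
    using assms by (auto simp: L2_def)
  show "(\<lambda>x. norm (f x) * norm (g x)) \<in> borel_measurable (lebesgue_on S)"
    using assms by (auto simp: L2_def)
  have "a * b \<le> a\<^sup>2 + b\<^sup>2" if "0 \<le> a" "0 \<le> b" for a b :: real
    using sum_squares_bound[of a b] mult_nonneg_nonneg[OF that] unfolding mult.assoc by linarith
  then show "AE x in lebesgue_on S. norm (norm (f x) * norm (g x)) \<le> norm ((norm (f x))\<^sup>2 + (norm (g x))\<^sup>2)"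
    by simp
qed

text \<open>The integral of (t |f| - |g|)^2 is a quadratic polynomial in t that is nonnegative for
  all real t; the claim is the condition on its discriminant.\<close>

lemma L2_norm_Cauchy_Schwarz:
  assumes "f \<in> L2 S" "g \<in> L2 S"
  shows "(\<integral>x. norm (f x) * norm (g x) \<partial>lebesgue_on S) \<le> L2_norm S f * L2_norm S g"
proof -
  let ?A = "L2_norm S f" and ?B = "L2_norm S g"
  let ?I = "\<integral>x. norm (f x) * norm (g x) \<partial>lebesgue_on S"
  have int: "integrable (lebesgue_on S) (\<lambda>x. (norm (f x))\<^sup>2)"
    "integrable (lebesgue_on S) (\<lambda>x. (norm (g x))\<^sup>2)"
    using assms by (auto simp: L2_def)
  have "0 \<le> t\<^sup>2 * ?A\<^sup>2 - 2 * t * ?I + ?B\<^sup>2" for t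
  proof -
    have "0 \<le> (\<integral>x. (t * norm (f x) - norm (g x))\<^sup>2 \<partial>lebesgue_on S)"
      by simp
    also have "\<dots> = (\<integral>x. t\<^sup>2 * (norm (f x))\<^sup>2 - 2 * t * (norm (f x) * norm (g x)) + (norm (g x))\<^sup>2 \<partial>lebesgue_on S)"
      by (intro Bochner_Integration.integral_cong) (auto simp: power2_eq_square algebra_simps)
    also have "\<dots> = t\<^sup>2 * ?A\<^sup>2 - 2 * t * ?I + ?B\<^sup>2"
      using int integrable_L2_product[OF assms]
      by (simp add: L2_norm_square del: Bochner_Integration.integral_mult_right_zero Bochner_Integration.integral_mult_left_zero)
    finally show ?thesis .
  qed note quad = this
  have "?I\<^sup>2 \<le> (?A * ?B)\<^sup>2"
  proof (cases "?A = 0")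
    case True
    \<comment> \<open>The polynomial is now affine in t. If \<open>?I\<close> were positive, the
      chosen t would give it the value \<open>- ?B\<^sup>2 - 2\<close>.\<close>
    have "?I \<le> 0"
    proof (rule ccontr)
      assume "\<not> ?I \<le> 0"
      then show False
        using quad[of "(?B\<^sup>2 + 1) / ?I"] True zero_le_power2[of ?B] by simp
    qed
    moreover have "0 \<le> ?I"
      by simp
    ultimately show ?thesis
      by simp
  next
    case False
    \<comment> \<open>The polynomial is evaluated at its minimiser
      \<open>?I / ?A\<^sup>2\<close>.\<close>
    then have "(?A * ?B)\<^sup>2 - ?I\<^sup>2 = ?A\<^sup>2 * ((?I / ?A\<^sup>2)\<^sup>2 * ?A\<^sup>2 - 2 * (?I / ?A\<^sup>2) * ?I + ?B\<^sup>2)"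
      by (simp add: power2_eq_square field_simps)
    also have "0 \<le> \<dots>"
      by (intro mult_nonneg_nonneg quad) simp
    finally show ?thesis
      by simp
  qed
  then show ?thesis
    by (rule power2_le_imp_le) (simp add: L2_norm_nonneg)
qed

lemma L2_add:
  assumes "f \<in> L2 S" "g \<in> L2 S"
  shows "(\<lambda>x. f x + g x) \<in> L2 S"
proof -
  have [measurable]: "f \<in> borel_measurable (lebesgue_on S)" "g \<in> borel_measurable (lebesgue_on S)"
    using assms by (auto simp: L2_def)
  have "integrable (lebesgue_on S) (\<lambda>x. (norm (f x + g x))\<^sup>2)"
  proof (rule Bochner_Integration.integrable_bound)
    show "integrable (lebesgue_on S) (\<lambda>x. (norm (f x))\<^sup>2 + 2 * (norm (f x) * norm (g x)) + (norm (g x))\<^sup>2)"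
      using assms integrable_L2_product[OF assms] by (auto simp: L2_def)
    have "(norm (f x + g x))\<^sup>2 \<le> (norm (f x) + norm (g x))\<^sup>2" for x
      by (intro power_mono norm_triangle_ineq) auto
    then show "AE x in lebesgue_on S. norm ((norm (f x + g x))\<^sup>2) \<le>
        norm ((norm (f x))\<^sup>2 + 2 * (norm (f x) * norm (g x)) + (norm (g x))\<^sup>2)"
      by (simp add: power2_sum algebra_simps)
  qed (auto intro!: borel_measurable_power borel_measurable_norm borel_measurable_add)
  then show ?thesis
    by (simp add: L2_def)
qed

lemma L2_norm_triangle:
  assumes "f \<in> L2 S" "g \<in> L2 S"
  shows "L2_norm S (\<lambda>x. f x + g x) \<le> L2_norm S f + L2_norm S g"
proof (rule power2_le_imp_le)
  have int: "integrable (lebesgue_on S) (\<lambda>x. (norm (f x))\<^sup>2)"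
    "integrable (lebesgue_on S) (\<lambda>x. (norm (g x))\<^sup>2)"
    "integrable (lebesgue_on S) (\<lambda>x. (norm (f x + g x))\<^sup>2)"
    using assms L2_add[OF assms] by (auto simp: L2_def)
  have "(L2_norm S (\<lambda>x. f x + g x))\<^sup>2
      \<le> (\<integral>x. (norm (f x))\<^sup>2 + 2 * (norm (f x) * norm (g x)) + (norm (g x))\<^sup>2 \<partial>lebesgue_on S)"
    unfolding L2_norm_square
  proof (rule integral_mono)
    fix x
    have "(norm (f x + g x))\<^sup>2 \<le> (norm (f x) + norm (g x))\<^sup>2"
      by (intro power_mono norm_triangle_ineq) auto
    then show "(norm (f x + g x))\<^sup>2 \<le> (norm (f x))\<^sup>2 + 2 * (norm (f x) * norm (g x)) + (norm (g x))\<^sup>2"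
      by (simp add: power2_sum algebra_simps)
  qed (use int integrable_L2_product[OF assms] in auto)
  also have "\<dots> = (L2_norm S f)\<^sup>2 + 2 * (\<integral>x. norm (f x) * norm (g x) \<partial>lebesgue_on S) + (L2_norm S g)\<^sup>2"
    using int integrable_L2_product[OF assms] by (simp add: L2_norm_square)
  also have "\<dots> \<le> (L2_norm S f + L2_norm S g)\<^sup>2"
    using L2_norm_Cauchy_Schwarz[OF assms] by (simp add: power2_sum)
  finally show "(L2_norm S (\<lambda>x. f x + g x))\<^sup>2 \<le> (L2_norm S f + L2_norm S g)\<^sup>2" .
qed (simp add: L2_norm_nonneg)

section \<open>Test functions and their gradients\<close>

lemma test_functions_has_derivative:
  assumes "\<phi> \<in> test_functions S"
  shows "(\<phi> has_derivative frechet_derivative \<phi> (at x)) (at x)"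
proof -
  have "Ck (Suc 0) \<phi>"
    using assms by (simp only: test_functions_def mem_Collect_eq)
  then show ?thesis
    by (simp flip: frechet_derivative_works)
qed

lemma test_functions_continuous:
  assumes "\<phi> \<in> test_functions S"
  shows "continuous_on A \<phi>" "continuous_on A (partial i \<phi>)"
proof -
  have "Ck 0 \<phi>" "Ck (Suc 0) \<phi>"
    using assms by (simp_all only: test_functions_def mem_Collect_eq)
  then show "continuous_on A \<phi>" "continuous_on A (partial i \<phi>)"
    by (auto intro: continuous_on_subset)
qed

lemma test_functions_partial_eq_0:
  assumes "\<phi> \<in> test_functions S" "x \<notin> closure {x. \<phi> x \<noteq> 0}"
  shows "partial i \<phi> x = 0"
proof -
  have "(\<phi> has_derivative (\<lambda>h. 0)) (at x)"
  proof (rule has_derivative_transform_within_open)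
    show "((\<lambda>x. 0) has_derivative (\<lambda>h. 0)) (at x)"
      by simp
    show "open (- closure {x. \<phi> x \<noteq> 0})" "x \<in> - closure {x. \<phi> x \<noteq> 0}"
      using assms by auto
    show "0 = \<phi> y" if "y \<in> - closure {x. \<phi> x \<noteq> 0}" for y
      using that closure_subset[of "{x. \<phi> x \<noteq> 0}"] by auto
  qed
  then have "frechet_derivative \<phi> (at x) = (\<lambda>h. 0)"
    by (rule frechet_derivative_at[symmetric])
  then show ?thesis
    by (simp add: partial_def)
qed

lemma continuous_on_gradient:
  assumes "\<phi> \<in> test_functions S"
  shows "continuous_on A (gradient \<phi>)"
  unfolding gradient_def using test_functions_continuous(2)[OF assms]
  by (intro continuous_intros) auto

lemma norm_gradient_square: "(norm (gradient \<phi> x))\<^sup>2 = (\<Sum>i\<in>UNIV. (norm (partial i \<phi> x))\<^sup>2)"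
proof -
  have "gradient \<phi> x $ i = partial i \<phi> x" for i
    by (simp add: gradient_def)
  then show ?thesis
    by (simp add: norm_vec_def[of "gradient \<phi> x"] L2_set_def sum_nonneg)
qed

section \<open>The logarithmic Hardy weight\<close>

text \<open>For |x| > \<epsilon> in the plane this is the weight of Leray's critical Hardy
  inequality. Division by zero makes it 0 at the origin and on the circle |x| = \<epsilon>, and
  between these it is negative, so every estimate with it is confined to |x| > \<epsilon>.\<close>

definition hardy_weight :: "real \<Rightarrow> 'a::real_normed_vector \<Rightarrow> real" where
  "hardy_weight \<epsilon> x = 1 / (norm x * ln (norm x / \<epsilon>))"

lemma borel_measurable_hardy_weight [measurable]:
  "(hardy_weight \<epsilon> :: 'a::euclidean_space \<Rightarrow> real) \<in> borel_measurable borel"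
  unfolding hardy_weight_def by measurable

lemma continuous_on_hardy_weight:
  assumes "\<epsilon> > 0" "A \<subseteq> - cball 0 \<epsilon>"
  shows "continuous_on A (hardy_weight \<epsilon>)"
proof -
  have "norm x \<noteq> 0 \<and> norm x / \<epsilon> > 0 \<and> ln (norm x / \<epsilon>) \<noteq> 0" if "x \<in> A" for x
  proof -
    have "\<epsilon> < norm x"
      using that assms(2) by auto
    then have "1 < norm x / \<epsilon>"
      using assms(1) by simp
    then have "ln (norm x / \<epsilon>) \<noteq> 0"
      using ln_gt_zero by fastforce
    moreover have "0 < norm x"
      using assms(1) \<open>\<epsilon> < norm x\<close> by linarith
    ultimately show ?thesis
      using assms(1) by (intro conjI divide_pos_pos) auto
  qed
  then show ?thesis
    using assms(1) unfolding hardy_weight_def by (intro continuous_intros) force+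
qed

lemma has_derivative_ln_norm:
  fixes x :: "'a::real_inner"
  assumes "\<epsilon> > 0" "x \<noteq> 0"
  shows "((\<lambda>x. ln (norm x / \<epsilon>)) has_derivative (\<lambda>h. (x \<bullet> h) / (x \<bullet> x))) (at x)"
proof -
  \<comment> \<open>The right side involves only the smooth inner product, whose derivative is
    immediate. Since \<open>ln 0 = 0\<close>, the identity holds at \<open>y = 0\<close> too, so the
    two functions are equal everywhere and the derivative carries over directly.\<close>
  have "ln (norm y / \<epsilon>) = ln ((y \<bullet> y) / \<epsilon>\<^sup>2) / 2" for y :: 'a
  proof (cases "y = 0")
    case False
    then have "ln ((norm y / \<epsilon>)\<^sup>2) = 2 * ln (norm y / \<epsilon>)"
      using assms(1) by (subst ln_realpow) auto
    then show ?thesis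
      by (simp add: power_divide dot_square_norm)
  qed simp
  moreover have "((\<lambda>y. ln ((y \<bullet> y) / \<epsilon>\<^sup>2) / 2) has_derivative (\<lambda>h. (x \<bullet> h) / (x \<bullet> x))) (at x)"
    using assms by (auto intro!: derivative_eq_intros simp: fun_eq_iff inner_commute field_simps)
  ultimately show ?thesis
    by presburger
qed

section \<open>Hardy's inequality for test fields\<close>

text \<open>Bridge between the plane with Borel sets, where translation invariance is available for
  the Hardy inequality, and the completed measure on \<open>S\<close>, in which the L2 norms are
  defined.\<close>

lemma lebesgue_on_zero_outside:
  fixes f :: "'a::euclidean_space \<Rightarrow> 'b::euclidean_space"
  assumes "f \<in> borel_measurable borel" "S \<in> sets lebesgue" "{x. f x \<noteq> 0} \<subseteq> S"
  shows "integrable (lebesgue_on S) f \<longleftrightarrow> integrable lborel f"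
    and "integral\<^sup>L (lebesgue_on S) f = integral\<^sup>L lborel f"
proof -
  have eq: "(\<lambda>x. indicator S x *\<^sub>R f x) = f"
    using assms(3) by (force simp: indicator_def)
  show "integrable (lebesgue_on S) f \<longleftrightarrow> integrable lborel f"
    using assms by (simp add: integrable_restrict_space eq integrable_completion)
  show "integral\<^sup>L (lebesgue_on S) f = integral\<^sup>L lborel f"
    using assms by (simp add: integral_restrict_space eq integral_completion)
qed

text \<open>The divergence of |phi|^2 F is 2 phi . (F . grad) phi - w^2 |phi|^2. Its integral
  vanishes, and Young's inequality absorbs half of the last term: 1/2 of the weighted integral is at
  most 2 times the Dirichlet integral, whence the factor 4.\<close>

lemma Hardy_inequality_test_functions:
  fixes \<phi> :: "real^2 \<Rightarrow> real^2"
  assumes \<phi>: "\<phi> \<in> test_functions S"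
    and \<epsilon>: "\<epsilon> > 0" and S: "S \<subseteq> - cball 0 \<epsilon>"
  shows "integrable lborel (\<lambda>x. (norm (hardy_weight \<epsilon> x *\<^sub>R \<phi> x))\<^sup>2)"
    and "integrable lborel (\<lambda>x. (norm (gradient \<phi> x))\<^sup>2)"
    and "(\<integral>x. (norm (hardy_weight \<epsilon> x *\<^sub>R \<phi> x))\<^sup>2 \<partial>lborel) \<le> 4 * (\<integral>x. (norm (gradient \<phi> x))\<^sup>2 \<partial>lborel)"
proof -
  define K where "K = closure {x. \<phi> x \<noteq> 0}"
  have K: "compact K" "K \<subseteq> S"
    using \<phi> by (auto simp: K_def test_functions_def)
  have zero: "\<phi> x = 0" "partial i \<phi> x = 0" if "x \<notin> K" for x i
    using that closure_subset[of "{x. \<phi> x \<noteq> 0}"] test_functions_partial_eq_0[OF \<phi>]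
    by (auto simp: K_def)
  define L where "L x = ln (norm x / \<epsilon>)" for x :: "real^2"
  have pos: "0 < norm x" "x \<noteq> 0" "0 < x \<bullet> x" "0 < L x" if "x \<in> K" for x
  proof -
    have "\<epsilon> < norm x"
      using that K S by auto
    then show "0 < norm x" "0 < L x"
      using \<epsilon> by (auto simp: L_def intro!: ln_gt_zero)
    then show "x \<noteq> 0" "0 < x \<bullet> x"
      by auto
  qed
  have contL: "continuous_on K L"
    unfolding L_def using pos(2) \<epsilon> by (intro continuous_intros) auto
  note cont = test_functions_continuous[OF \<phi>]
  show int_w: "integrable lborel (\<lambda>x. (norm (hardy_weight \<epsilon> x *\<^sub>R \<phi> x))\<^sup>2)"
  proof (rule integrable_continuous_compact_support[OF K(1)])
    have "continuous_on K (hardy_weight \<epsilon>)"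
      using K(2) S by (intro continuous_on_hardy_weight \<epsilon>) auto
    then show "continuous_on K (\<lambda>x. (norm (hardy_weight \<epsilon> x *\<^sub>R \<phi> x))\<^sup>2)"
      by (intro continuous_intros cont)
  qed (simp add: zero)
  show int_g: "integrable lborel (\<lambda>x. (norm (gradient \<phi> x))\<^sup>2)"
    by (rule integrable_continuous_compact_support[OF K(1)])
      (intro continuous_intros continuous_on_gradient[OF \<phi>], simp add: norm_gradient_square zero)
  (* g i is the i-th component of |phi|^2 F, and d i x its derivative at x. *)
  define g where "g i x = x $ i * (\<phi> x \<bullet> \<phi> x) / ((x \<bullet> x) * L x)" for i x
  define d where "d i x h = (if x \<in> K then
      (h $ i * (\<phi> x \<bullet> \<phi> x) + x $ i * (2 * (\<phi> x \<bullet> frechet_derivative \<phi> (at x) h))) / ((x \<bullet> x) * L x)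
      - x $ i * (\<phi> x \<bullet> \<phi> x) * ((x \<bullet> h) * (2 * L x + 1)) / ((x \<bullet> x) * L x)\<^sup>2 else 0)" for i x and h :: "real^2"
  \<comment> \<open>On \<open>K\<close> the quotient rule applies, as |x|^2 L is nonzero there and
    has the derivative (x . h) (2 L + 1). Off \<open>K\<close>, in particular at the singular
    points, \<open>g i\<close> vanishes on the open set \<open>- K\<close>.\<close>
  have der: "(g i has_derivative d i x) (at x)" for i x
  proof (cases "x \<in> K")
    case True
    have L': "(L has_derivative (\<lambda>h. (x \<bullet> h) / (x \<bullet> x))) (at x)"
      unfolding L_def using \<epsilon> pos(2)[OF True] by (rule has_derivative_ln_norm)
    have nth: "((\<lambda>x. x $ i) has_derivative (\<lambda>h. h $ i)) (at x)"
      by (rule bounded_linear_imp_has_derivative) (rule bounded_linear_vec_nth)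
    note num = has_derivative_mult[OF nth has_derivative_inner[OF
          test_functions_has_derivative[OF \<phi>] test_functions_has_derivative[OF \<phi>]]]
    note den = has_derivative_mult[OF has_derivative_inner[OF has_derivative_ident has_derivative_ident] L']
    have "(g i has_derivative (\<lambda>h.
        - (x $ i * (\<phi> x \<bullet> \<phi> x)) * (inverse ((x \<bullet> x) * L x) *
          ((x \<bullet> x) * ((x \<bullet> h) / (x \<bullet> x)) + (x \<bullet> h + h \<bullet> x) * L x) * inverse ((x \<bullet> x) * L x))
        + (x $ i * (\<phi> x \<bullet> frechet_derivative \<phi> (at x) h + frechet_derivative \<phi> (at x) h \<bullet> \<phi> x)
          + h $ i * (\<phi> x \<bullet> \<phi> x)) / ((x \<bullet> x) * L x))) (at x)" (is "(_ has_derivative ?D) _")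
      unfolding g_def using pos[OF True] by (intro has_derivative_divide[OF num den]) auto
    moreover have "?D = d i x"
    proof
      fix h
      \<comment> \<open>The vector terms are abstracted to reals: \<open>N\<close> is |x|^2,
        \<open>l\<close> is L, \<open>p\<close> and \<open>k\<close> are the i-th components of
        \<open>x\<close> and \<open>h\<close>, \<open>q\<close> is |phi|^2, \<open>b\<close> is x .
        h, and \<open>c\<close> is the inner product of phi with its derivative along
        \<open>h\<close>.\<close>
      have "- (p * q) * (inverse (N * l) * (N * (b / N) + (b + b) * l) * inverse (N * l)) + (p * (c + c) + k * q) / (N * l)
          = (k * q + p * (2 * c)) / (N * l) - p * q * (b * (2 * l + 1)) / (N * l)\<^sup>2"
        if "N \<noteq> 0" "l \<noteq> 0" for N l p q b c k :: real
        using that by (simp add: power2_eq_square field_simps)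
      then show "?D h = d i x h"
        using True pos[OF True] unfolding d_def inner_commute[of h x]
          inner_commute[of "frechet_derivative \<phi> (at x) h" "\<phi> x"] by simp
    qed
    ultimately show ?thesis
      by simp
  next
    case False
    have "(g i has_derivative (\<lambda>h. 0)) (at x)"
    proof (rule has_derivative_transform_within_open)
      show "((\<lambda>x. 0) has_derivative (\<lambda>h. 0)) (at x)"
        by simp
      show "open (- K)" "x \<in> - K"
        using K(1) False by (auto dest: compact_imp_closed)
    qed (simp add: g_def zero)
    moreover have "(\<lambda>h. 0) = d i x"
      using False by (simp add: d_def fun_eq_iff)
    ultimately show ?thesis
      by simp
  qed
  have d_axis: "d i x (axis i 1) = (if x \<in> K then
      (\<phi> x \<bullet> \<phi> x + x $ i * (2 * (\<phi> x \<bullet> partial i \<phi> x))) / ((x \<bullet> x) * L x)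
      - x $ i * (\<phi> x \<bullet> \<phi> x) * (x $ i * (2 * L x + 1)) / ((x \<bullet> x) * L x)\<^sup>2 else 0)" for i x
    by (simp add: d_def inner_axis flip: partial_def)
  have "\<exists>C. \<forall>x. \<bar>d i x (axis i 1)\<bar> \<le> C" for i
  proof -
    have "continuous_on K (\<lambda>x. (\<phi> x \<bullet> \<phi> x + x $ i * (2 * (\<phi> x \<bullet> partial i \<phi> x))) / ((x \<bullet> x) * L x)
      - x $ i * (\<phi> x \<bullet> \<phi> x) * (x $ i * (2 * L x + 1)) / ((x \<bullet> x) * L x)\<^sup>2)" (is "continuous_on K ?e")
      using pos by (intro continuous_intros cont contL) force+
    then have "bounded (?e ` K)"
      using K(1) by (intro compact_imp_bounded compact_continuous_image)
    then obtain C where "\<And>x. x \<in> K \<Longrightarrow> \<bar>?e x\<bar> \<le> C"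
      by (auto simp: bounded_iff)
    \<comment> \<open>The maximum with 0 serves the points off \<open>K\<close>: when
      \<open>K\<close> is empty, \<open>C\<close> may be negative.\<close>
    then have "\<bar>d i x (axis i 1)\<bar> \<le> max C 0" for x
      unfolding d_axis by (auto simp: le_max_iff_disj)
    then show ?thesis
      by blast
  qed
  then obtain C where C: "\<And>i x. \<bar>d i x (axis i 1)\<bar> \<le> C i"
    by metis
  have g0: "g i x = 0" if "x \<notin> K" for i x
    using that by (simp add: g_def zero)
  note int_d = integral_directional_derivative_eq_0[OF der C compact_imp_bounded[OF K(1)] g0]
  have ptw: "(\<Sum>i\<in>UNIV. d i x (axis i 1)) \<le>
      2 * (norm (gradient \<phi> x))\<^sup>2 - (norm (hardy_weight \<epsilon> x *\<^sub>R \<phi> x))\<^sup>2 / 2" for x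
  proof (cases "x \<in> K")
    case True
    define a where "a = norm (hardy_weight \<epsilon> x *\<^sub>R \<phi> x)"
    have a: "a\<^sup>2 = (\<phi> x \<bullet> \<phi> x) / ((x \<bullet> x) * (L x)\<^sup>2)"
      by (simp add: a_def hardy_weight_def L_def power_mult_distrib power_divide dot_square_norm)
    \<comment> \<open>This is (x . grad) phi, that is, |x| times the radial derivative.\<close>
    define y where "y = (\<Sum>i\<in>UNIV. x $ i *\<^sub>R partial i \<phi> x)"
    have xx: "(x $ 1)\<^sup>2 + (x $ 2)\<^sup>2 = x \<bullet> x"
      by (simp add: inner_vec_def sum_2 power2_eq_square)
    have "(\<Sum>i\<in>UNIV. d i x (axis i 1)) =
        (2 * (\<phi> x \<bullet> \<phi> x) + 2 * (\<phi> x \<bullet> y)) / ((x \<bullet> x) * L x)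
        - ((x $ 1)\<^sup>2 + (x $ 2)\<^sup>2) * (\<phi> x \<bullet> \<phi> x) * (2 * L x + 1) / ((x \<bullet> x) * L x)\<^sup>2"
      using True pos[OF True]
      by (simp add: d_axis sum_2 y_def inner_add_right power2_eq_square add_divide_distrib algebra_simps)
    \<comment> \<open>Dimension two enters here: the 2 from div x cancels the 2 L from
      differentiating |x|^2, and only \<open>a\<^sup>2\<close>, the square of the weighted field,
      survives.\<close>
    also have "\<dots> = 2 * (\<phi> x \<bullet> y) / ((x \<bullet> x) * L x) - a\<^sup>2"
      using pos[OF True] unfolding xx a by (simp add: field_simps power2_eq_square)
    also have "2 * (\<phi> x \<bullet> y) / ((x \<bullet> x) * L x) \<le> 2 * (a * norm (gradient \<phi> x))"
    proof -
      have "norm y \<le> norm x * norm (gradient \<phi> x)"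
      proof -
        have "norm y \<le> (\<Sum>i\<in>UNIV. \<bar>x $ i\<bar> * norm (partial i \<phi> x))"
          unfolding y_def by (rule order_trans[OF norm_sum]) simp
        also have "\<dots> \<le> L2_set (\<lambda>i. x $ i) UNIV * L2_set (\<lambda>i. norm (partial i \<phi> x)) UNIV"
          using L2_set_mult_ineq[of "\<lambda>i. x $ i" "\<lambda>i. norm (partial i \<phi> x)" UNIV] by simp
        also have "\<dots> = norm x * norm (gradient \<phi> x)"
          by (simp add: norm_vec_def gradient_def L2_set_def vec_lambda_eta)
        finally show ?thesis .
      qed
      then have "\<phi> x \<bullet> y \<le> norm (\<phi> x) * (norm x * norm (gradient \<phi> x))"
        by (meson norm_cauchy_schwarz mult_left_mono norm_ge_zero order_trans)
      then have "(\<phi> x \<bullet> y) / ((x \<bullet> x) * L x) \<le> norm (\<phi> x) * (norm x * norm (gradient \<phi> x)) / ((x \<bullet> x) * L x)"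
        using pos[OF True] by (intro divide_right_mono) auto
      also have "\<dots> = a * norm (gradient \<phi> x)"
        using pos[OF True]
        by (simp add: a_def hardy_weight_def dot_square_norm power2_eq_square field_simps flip: L_def)
      finally show ?thesis
        by simp
    qed
    \<comment> \<open>Bounding 2ab by t a^2 + b^2/t would lead to the Hardy constant 1/(t (1 - t)),
      which is least for t = 1/2.\<close>
    also have "2 * (a * norm (gradient \<phi> x)) \<le> a\<^sup>2 / 2 + 2 * (norm (gradient \<phi> x))\<^sup>2"
      using zero_le_power2[of "a - 2 * norm (gradient \<phi> x)"] by (simp add: power2_eq_square algebra_simps)
    finally show ?thesis
      by (simp add: a_def)
  next
    case False
    then show ?thesis
      by (simp add: d_axis zero norm_gradient_square)
  qed
  have "0 = (\<integral>x. (\<Sum>i\<in>UNIV. d i x (axis i 1)) \<partial>lborel)"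
    using int_d by simp
  also have "\<dots> \<le> (\<integral>x. 2 * (norm (gradient \<phi> x))\<^sup>2 - (norm (hardy_weight \<epsilon> x *\<^sub>R \<phi> x))\<^sup>2 / 2 \<partial>lborel)"
    using int_d(1) int_w int_g ptw by (intro integral_mono) auto
  also have "\<dots> = 2 * (\<integral>x. (norm (gradient \<phi> x))\<^sup>2 \<partial>lborel)
      - (\<integral>x. (norm (hardy_weight \<epsilon> x *\<^sub>R \<phi> x))\<^sup>2 \<partial>lborel) / 2"
    using int_w int_g by (subst Bochner_Integration.integral_diff) auto
  finally show "(\<integral>x. (norm (hardy_weight \<epsilon> x *\<^sub>R \<phi> x))\<^sup>2 \<partial>lborel) \<le> 4 * (\<integral>x. (norm (gradient \<phi> x))\<^sup>2 \<partial>lborel)"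
    by simp
qed

section \<open>Restriction, domination and compact exhaustion in L2\<close>

lemma L2_restrict:
  assumes "f \<in> L2 S" "K \<in> sets lebesgue" "S \<in> sets lebesgue" "K \<subseteq> S"
  shows "f \<in> L2 K" "L2_norm K f \<le> L2_norm S f"
proof -
  have eq: "indicat_real K x * (indicat_real S x * y) = indicat_real K x * y" for x y
    using assms(4) by (auto simp: indicator_def)
  have S: "integrable lebesgue (\<lambda>x. indicat_real S x * (norm (f x))\<^sup>2)"
    using assms(1,3) by (simp add: L2_def integrable_restrict_space)
  have K: "integrable lebesgue (\<lambda>x. indicat_real K x * (norm (f x))\<^sup>2)"
    using integrable_mult_indicator[OF assms(2) S] by (simp add: eq)
  have "f \<in> borel_measurable (lebesgue_on K)"
    using assms(1,4) by (auto simp: L2_def intro: measurable_restrict_mono)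
  then show "f \<in> L2 K"
    using K assms(2) by (simp add: L2_def integrable_restrict_space)
  have "(\<integral>x. indicat_real K x * (norm (f x))\<^sup>2 \<partial>lebesgue) \<le> (\<integral>x. indicat_real S x * (norm (f x))\<^sup>2 \<partial>lebesgue)"
    using assms(4) by (intro integral_mono K S) (auto simp: indicator_def)
  then show "L2_norm K f \<le> L2_norm S f"
    using assms(2,3) by (simp add: L2_norm_def integral_restrict_space)
qed

lemma L2_bound:
  assumes f: "f \<in> borel_measurable (lebesgue_on S)" and g: "g \<in> L2 S" and "0 \<le> c"
    and le: "\<And>x. x \<in> S \<Longrightarrow> norm (f x) \<le> c * norm (g x)"
  shows "f \<in> L2 S" "L2_norm S f \<le> c * L2_norm S g"
proof -
  have int: "integrable (lebesgue_on S) (\<lambda>x. c\<^sup>2 * (norm (g x))\<^sup>2)"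
    using g by (simp add: L2_def)
  have le': "(norm (f x))\<^sup>2 \<le> c\<^sup>2 * (norm (g x))\<^sup>2" if "x \<in> space (lebesgue_on S)" for x
    using le[of x] that by (metis IntD1 norm_ge_zero power_mono power_mult_distrib space_restrict_space)
  have f_int: "integrable (lebesgue_on S) (\<lambda>x. (norm (f x))\<^sup>2)"
  proof (rule Bochner_Integration.integrable_bound[OF int])
    show "(\<lambda>x. (norm (f x))\<^sup>2) \<in> borel_measurable (lebesgue_on S)"
      by (rule borel_measurable_power[OF measurable_compose[OF f borel_measurable_norm]])
    show "AE x in lebesgue_on S. norm ((norm (f x))\<^sup>2) \<le> norm (c\<^sup>2 * (norm (g x))\<^sup>2)"
      using le' by (intro AE_I2) (simp add: abs_mult)
  qed
  then show "f \<in> L2 S"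
    using f by (simp add: L2_def)
  have "(L2_norm S f)\<^sup>2 \<le> (c * L2_norm S g)\<^sup>2"
    using integral_mono[OF f_int int le'] by (simp add: L2_norm_square power_mult_distrib)
  then show "L2_norm S f \<le> c * L2_norm S g"
    by (rule power2_le_imp_le) (simp add: L2_norm_nonneg \<open>0 \<le> c\<close>)
qed

lemma borel_measurable_lebesgue_onI:
  "f \<in> borel_measurable borel \<Longrightarrow> f \<in> borel_measurable (lebesgue_on S)"
  by (intro measurable_restrict_space1 measurable_completion) simp

lemma compact_sets_lebesgue: "compact K \<Longrightarrow> K \<in> sets lebesgue"
  by (intro fmeasurableD lmeasurable_compact)

text \<open>Monotone convergence along an exhaustion of \<open>S\<close> by compact sets. It is
  essential that the same \<open>c\<close> serves every \<open>K\<close>.\<close>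

lemma L2_exhaustion:
  assumes "open S" and f: "f \<in> borel_measurable (lebesgue_on S)"
    and bound: "\<And>K. compact K \<Longrightarrow> K \<subseteq> S \<Longrightarrow> f \<in> L2 K \<and> L2_norm K f \<le> c"
  shows "f \<in> L2 S" "L2_norm S f \<le> c"
proof -
  obtain C where C': "\<forall>n. compact (C n) \<and> C n \<subseteq> S \<and> C n \<subseteq> interior (C (Suc n))" "\<Union> (range C) = S"
    by (rule open_Union_compact_subsets[OF \<open>open S\<close>]) (rule that, simp_all)
  then have C: "compact (C n)" "C n \<subseteq> S" "C n \<subseteq> interior (C (Suc n))" for n
    by auto
  have mono: "C m \<subseteq> C n" if "m \<le> n" for m n
    using that by (rule lift_Suc_mono_le[of C, rotated]) (use C(3) interior_subset in blast)
  have meas: "S \<in> sets lebesgue" "C n \<in> sets lebesgue" for n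
    using \<open>open S\<close> C(1) by (auto intro: compact_sets_lebesgue)
  \<comment> \<open>The empty set is an admissible \<open>K\<close>, which forces \<open>c\<close>
    to be nonnegative.\<close>
  have c0: "0 \<le> c"
    using bound[of "{}"] L2_norm_nonneg[of "{}" f] by simp
  have f2: "(\<lambda>x. (norm (f x))\<^sup>2) \<in> borel_measurable (lebesgue_on S)"
    by (rule borel_measurable_power[OF measurable_compose[OF f borel_measurable_norm]])
  \<comment> \<open>Indicators move all integrals to one measure space, on which \<open>h n\<close>
    increases to \<open>H\<close>.\<close>
  define h where "h n x = indicat_real (C n) x * (norm (f x))\<^sup>2" for n x
  define H where "H x = indicat_real S x * (norm (f x))\<^sup>2" for x
  have int: "integrable lebesgue (h n)" for n
    using bound[OF C(1,2), of n] meas(2)[of n] by (simp add: L2_def integrable_restrict_space h_def[abs_def])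
  have int_le: "integral\<^sup>L lebesgue (h n) \<le> c\<^sup>2" for n
  proof -
    have "integral\<^sup>L lebesgue (h n) = (L2_norm (C n) f)\<^sup>2"
      using meas(2)[of n] by (simp add: L2_norm_square integral_restrict_space h_def[abs_def])
    also have "\<dots> \<le> c\<^sup>2"
      using bound[OF C(1,2), of n] by (intro power_mono L2_norm_nonneg) auto
    finally show ?thesis .
  qed
  have h_mono: "h m x \<le> h n x" if "m \<le> n" for m n x
    using mono[OF that] by (auto simp: h_def indicator_def)
  have lim: "(\<lambda>n. h n x) \<longlonglongrightarrow> H x" for x
  proof (cases "x \<in> S")
    case True
    then obtain m where "x \<in> C m"
      using C'(2) by auto
    then have "h n x = H x" if "n \<ge> m" for n
      using mono[OF that] True by (auto simp: h_def H_def)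
    then show ?thesis
      by (intro tendsto_eventually) (auto simp: eventually_sequentially)
  next
    case False
    then have "h n x = H x" for n
      using C(2)[of n] by (auto simp: h_def H_def indicator_def)
    then show ?thesis
      by simp
  qed
  have H_meas: "H \<in> borel_measurable lebesgue"
    using f2 meas(1) by (simp add: borel_measurable_restrict_space_iff H_def[abs_def])
  have "incseq (\<lambda>n. integral\<^sup>L lebesgue (h n))"
    by (intro monoI integral_mono int h_mono)
  then obtain l where l: "(\<lambda>n. integral\<^sup>L lebesgue (h n)) \<longlonglongrightarrow> l"
    using incseq_convergent int_le by blast
  have "has_bochner_integral lebesgue H l"
    by (rule has_bochner_integral_monotone_convergence[OF int _ _ l H_meas])
      (auto intro!: AE_I2 monoI h_mono lim)
  then have H: "integrable lebesgue H" "integral\<^sup>L lebesgue H = l"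
    by (auto simp: has_bochner_integral_iff)
  then show "f \<in> L2 S"
    using f meas(1) by (simp add: L2_def integrable_restrict_space H_def[abs_def])
  have "l \<le> c\<^sup>2"
    using l int_le by (intro LIMSEQ_le_const2) auto
  moreover have "(L2_norm S f)\<^sup>2 = l"
    using meas(1) H(2) by (simp add: L2_norm_square integral_restrict_space H_def[abs_def])
  ultimately have "(L2_norm S f)\<^sup>2 \<le> c\<^sup>2"
    by simp
  then show "L2_norm S f \<le> c"
    using c0 by (rule power2_le_imp_le)
qed

section \<open>Hardy's inequality on the completion\<close>

lemma test_functions_L2:
  assumes "\<phi> \<in> test_functions S" "compact K"
  shows "\<phi> \<in> L2 K"
proof -
  have "\<phi> \<in> borel_measurable borel"
    by (intro borel_measurable_continuous_onI test_functions_continuous[OF assms(1)])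
  moreover have "integrable lborel (\<lambda>x. indicator K x *\<^sub>R (norm (\<phi> x))\<^sup>2)"
    by (intro borel_integrable_compact assms(2) continuous_intros test_functions_continuous[OF assms(1)])
  moreover have "K \<in> sets lebesgue" "K \<in> sets borel"
    using assms(2) by (auto intro: compact_sets_lebesgue borel_compact)
  ultimately show ?thesis
    by (simp add: L2_def borel_measurable_lebesgue_onI integrable_restrict_space integrable_completion)
qed

text \<open>The closed support lies in \<open>S\<close>, so the weighted field and the gradient both
  vanish off \<open>S\<close> and the integrals over the plane are squared norms over
  \<open>S\<close>. Taking roots turns 4 into 2.\<close>

lemma Hardy_inequality_L2_norm:
  fixes \<phi> :: "real^2 \<Rightarrow> real^2"
  assumes \<phi>: "\<phi> \<in> test_functions S"
    and "open S" "\<epsilon> > 0" "S \<subseteq> - cball 0 \<epsilon>"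
  shows "(\<lambda>x. hardy_weight \<epsilon> x *\<^sub>R \<phi> x) \<in> L2 S" "gradient \<phi> \<in> L2 S"
    and "L2_norm S (\<lambda>x. hardy_weight \<epsilon> x *\<^sub>R \<phi> x) \<le> 2 * L2_norm S (gradient \<phi>)"
proof -
  let ?f = "\<lambda>x. hardy_weight \<epsilon> x *\<^sub>R \<phi> x"
  note Hardy = Hardy_inequality_test_functions[OF \<phi> assms(3,4)]
  have S: "S \<in> sets lebesgue"
    using \<open>open S\<close> by auto
  have [measurable]: "\<phi> \<in> borel_measurable borel" "gradient \<phi> \<in> borel_measurable borel"
    by (intro borel_measurable_continuous_onI test_functions_continuous[OF \<phi>] continuous_on_gradient[OF \<phi>])+
  have f_meas: "?f \<in> borel_measurable borel"
    by measurable
  have sq_meas: "(\<lambda>x. (norm (?f x))\<^sup>2) \<in> borel_measurable borel"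
    "(\<lambda>x. (norm (gradient \<phi> x))\<^sup>2) \<in> borel_measurable borel"
    by measurable
  have "closure {x. \<phi> x \<noteq> 0} \<subseteq> S"
    using \<phi> by (simp add: test_functions_def)
  then have out: "x \<notin> closure {x. \<phi> x \<noteq> 0}" "\<phi> x = 0" if "x \<notin> S" for x
    using that closure_subset[of "{x. \<phi> x \<noteq> 0}"] by auto
  have "(norm (?f x))\<^sup>2 = 0" "(norm (gradient \<phi> x))\<^sup>2 = 0" if "x \<notin> S" for x
    using out[OF that] test_functions_partial_eq_0[OF \<phi>, of x] unfolding norm_gradient_square
    by simp_all
  then have supp: "{x. (norm (?f x))\<^sup>2 \<noteq> 0} \<subseteq> S" "{x. (norm (gradient \<phi> x))\<^sup>2 \<noteq> 0} \<subseteq> S"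
    by blast+
  note eq_f = lebesgue_on_zero_outside[OF sq_meas(1) S supp(1)]
  note eq_g = lebesgue_on_zero_outside[OF sq_meas(2) S supp(2)]
  show "?f \<in> L2 S"
    using Hardy(1) eq_f(1) f_meas by (simp add: L2_def borel_measurable_lebesgue_onI)
  show "gradient \<phi> \<in> L2 S"
    using Hardy(2) eq_g(1) by (simp add: L2_def borel_measurable_lebesgue_onI)
  have "(L2_norm S ?f)\<^sup>2 \<le> 4 * (L2_norm S (gradient \<phi>))\<^sup>2"
    using Hardy(3) by (simp only: L2_norm_square eq_f(2) eq_g(2))
  then have "(L2_norm S ?f)\<^sup>2 \<le> (2 * L2_norm S (gradient \<phi>))\<^sup>2"
    by (simp add: power_mult_distrib)
  then show "L2_norm S ?f \<le> 2 * L2_norm S (gradient \<phi>)"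
    by (rule power2_le_imp_le) (simp add: L2_norm_nonneg)
qed

lemma Hardy_inequality_H1dot_0_sigma:
  assumes "open S" and \<epsilon>: "\<epsilon> > 0" "S \<subseteq> - cball 0 \<epsilon>" and v: "v \<in> H1dot_0_sigma S"
  shows "(\<lambda>x. hardy_weight \<epsilon> x *\<^sub>R v x) \<in> L2 S"
    and "L2_norm S (\<lambda>x. hardy_weight \<epsilon> x *\<^sub>R v x) \<le> 2 * L2_norm S (weak_gradient S v)"
proof -
  define G where "G = weak_gradient S v"
  define w :: "real^2 \<Rightarrow> real" where "w = hardy_weight \<epsilon>"
  have S: "S \<in> sets lebesgue"
    using \<open>open S\<close> by auto
  have w_meas: "w \<in> borel_measurable (lebesgue_on A)" for A
    unfolding w_def by (intro borel_measurable_lebesgue_onI borel_measurable_hardy_weight)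
  have G: "G \<in> L2 S" and v_L2: "\<And>K. compact K \<Longrightarrow> K \<subseteq> S \<Longrightarrow> v \<in> L2 K"
    and approx: "\<exists>\<phi>. (\<forall>n::nat. \<phi> n \<in> solenoidal_test_fields S) \<and>
        (\<lambda>n. L2_norm S (\<lambda>x. gradient (\<phi> n) x - G x)) \<longlonglongrightarrow> 0 \<and>
        (\<forall>K. compact K \<and> K \<subseteq> S \<longrightarrow> (\<lambda>n. L2_norm K (\<lambda>x. \<phi> n x - v x)) \<longlonglongrightarrow> 0)"
    using v unfolding H1dot_0_sigma_def mem_Collect_eq G_def by simp_all
  obtain \<phi> where "\<forall>n::nat. \<phi> n \<in> solenoidal_test_fields S"
    and lim_G: "(\<lambda>n. L2_norm S (\<lambda>x. gradient (\<phi> n) x - G x)) \<longlonglongrightarrow> 0"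
    and lim: "\<forall>K. compact K \<and> K \<subseteq> S \<longrightarrow> (\<lambda>n. L2_norm K (\<lambda>x. \<phi> n x - v x)) \<longlonglongrightarrow> 0"
    using approx by (elim exE conjE)
  then have \<phi>: "\<phi> n \<in> test_functions S" for n
    by (simp add: solenoidal_test_fields_def)
  have "v \<in> borel_measurable (lebesgue_on S)"
    using v by (auto simp: H1dot_0_sigma_def has_weak_gradient_def locally_L1_def)
  then have wv_meas: "(\<lambda>x. w x *\<^sub>R v x) \<in> borel_measurable (lebesgue_on S)"
    by (intro borel_measurable_scaleR w_meas)
  have local: "(\<lambda>x. w x *\<^sub>R v x) \<in> L2 K \<and> L2_norm K (\<lambda>x. w x *\<^sub>R v x) \<le> 2 * L2_norm S G"
    if K: "compact K" "K \<subseteq> S" for K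
  proof -
    have K': "K \<in> sets lebesgue"
      using K(1) by (rule compact_sets_lebesgue)
    have "bounded (w ` K)"
      unfolding w_def using K \<epsilon>
      by (intro compact_imp_bounded compact_continuous_image continuous_on_hardy_weight) auto
    \<comment> \<open>\<open>M\<close> depends on \<open>K\<close>, but it will only multiply the
      distance of \<open>\<phi> n\<close> from \<open>v\<close> on \<open>K\<close>, which tends to
      0.\<close>
    then obtain M where M: "0 < M" "\<And>x. x \<in> K \<Longrightarrow> \<bar>w x\<bar> \<le> M"
      by (auto simp: bounded_pos)
    have wf: "(\<lambda>x. w x *\<^sub>R f x) \<in> L2 K" "L2_norm K (\<lambda>x. w x *\<^sub>R f x) \<le> M * L2_norm K f"
      if "f \<in> L2 K" for f :: "real^2 \<Rightarrow> real^2"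
    proof -
      have "(\<lambda>x. w x *\<^sub>R f x) \<in> borel_measurable (lebesgue_on K)"
        using that by (intro borel_measurable_scaleR w_meas) (simp add: L2_def)
      moreover have "norm (w x *\<^sub>R f x) \<le> M * norm (f x)" if "x \<in> K" for x
        using M(2)[OF that] by (simp add: mult_right_mono)
      ultimately show "(\<lambda>x. w x *\<^sub>R f x) \<in> L2 K" "L2_norm K (\<lambda>x. w x *\<^sub>R f x) \<le> M * L2_norm K f"
        using L2_bound[where g = f and c = M] that M(1) by (blast intro: less_imp_le)+
    qed
    have "L2_norm K (\<lambda>x. w x *\<^sub>R v x) \<le>
        2 * (L2_norm S G + L2_norm S (\<lambda>x. gradient (\<phi> n) x - G x)) + M * L2_norm K (\<lambda>x. \<phi> n x - v x)" for n
    proof -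
      note Hardy = Hardy_inequality_L2_norm[OF \<phi>[of n] \<open>open S\<close> \<epsilon>, folded w_def]
      have minus: "(\<lambda>x. - f x) \<in> L2 A" if "f \<in> L2 A" for f :: "real^2 \<Rightarrow> 'c::euclidean_space" and A
        using that by (simp add: L2_def)
      have diff_v: "(\<lambda>x. \<phi> n x - v x) \<in> L2 K"
        using L2_add[OF test_functions_L2[OF \<phi>[of n] K(1)] minus[OF v_L2[OF K]]] by simp
      have diff_G: "(\<lambda>x. gradient (\<phi> n) x - G x) \<in> L2 S"
        using L2_add[OF Hardy(2) minus[OF G]] by simp
      \<comment> \<open>Writing w v as w phi_n - w (phi_n - v) lets the Hardy inequality act on the
        first part and the bound \<open>M\<close> on the second.\<close>
      have "L2_norm K (\<lambda>x. w x *\<^sub>R \<phi> n x + - (w x *\<^sub>R (\<phi> n x - v x)))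
          \<le> L2_norm K (\<lambda>x. w x *\<^sub>R \<phi> n x) + L2_norm K (\<lambda>x. - (w x *\<^sub>R (\<phi> n x - v x)))"
        by (rule L2_norm_triangle[OF wf(1)[OF test_functions_L2[OF \<phi> K(1)]] minus[OF wf(1)[OF diff_v]]])
      moreover have "w x *\<^sub>R \<phi> n x + - (w x *\<^sub>R (\<phi> n x - v x)) = w x *\<^sub>R v x" for x
        by (simp add: algebra_simps)
      moreover have "L2_norm K (\<lambda>x. - (w x *\<^sub>R (\<phi> n x - v x))) = L2_norm K (\<lambda>x. w x *\<^sub>R (\<phi> n x - v x))"
        unfolding L2_norm_def norm_minus_cancel ..
      moreover have "L2_norm K (\<lambda>x. w x *\<^sub>R \<phi> n x) \<le> L2_norm S (\<lambda>x. w x *\<^sub>R \<phi> n x)"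
        by (rule L2_restrict(2)[OF Hardy(1) K' S K(2)])
      moreover have "L2_norm S (gradient (\<phi> n)) \<le> L2_norm S G + L2_norm S (\<lambda>x. gradient (\<phi> n) x - G x)"
        using L2_norm_triangle[OF G diff_G] by simp
      ultimately show ?thesis
        using Hardy(3) wf(2)[OF diff_v] by simp
    qed
    moreover have "(\<lambda>n. 2 * (L2_norm S G + L2_norm S (\<lambda>x. gradient (\<phi> n) x - G x)) + M * L2_norm K (\<lambda>x. \<phi> n x - v x))
        \<longlonglongrightarrow> 2 * (L2_norm S G + 0) + M * 0"
      by (intro tendsto_intros lim_G lim[rule_format] conjI K)
    ultimately have "L2_norm K (\<lambda>x. w x *\<^sub>R v x) \<le> 2 * (L2_norm S G + 0) + M * 0"
      by (intro LIMSEQ_le_const) auto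
    then show ?thesis
      using wf(1)[OF v_L2[OF K]] by simp
  qed
  have "(\<lambda>x. w x *\<^sub>R v x) \<in> L2 S"
    by (rule L2_exhaustion(1)[OF \<open>open S\<close> wv_meas]) (rule local)
  moreover have "L2_norm S (\<lambda>x. w x *\<^sub>R v x) \<le> 2 * L2_norm S G"
    by (rule L2_exhaustion(2)[OF \<open>open S\<close> wv_meas]) (rule local)
  ultimately show "(\<lambda>x. hardy_weight \<epsilon> x *\<^sub>R v x) \<in> L2 S"
    "L2_norm S (\<lambda>x. hardy_weight \<epsilon> x *\<^sub>R v x) \<le> 2 * L2_norm S (weak_gradient S v)"
    unfolding w_def G_def .
qed

section \<open>The trilinear estimate\<close>

text \<open>Cauchy-Schwarz is used twice, for each row of \<open>A\<close> against \<open>b\<close>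
  and then for \<open>a\<close> against the resulting vector; the Frobenius norm dominates the
  operator norm.\<close>

lemma abs_bilinear_form_le:
  fixes A :: "real^'n^'m"
  shows "\<bar>\<Sum>i\<in>UNIV. \<Sum>j\<in>UNIV. a $ i * A $ i $ j * b $ j\<bar> \<le> norm a * norm A * norm b"
proof -
  define y where "y = (\<chi> i. A $ i \<bullet> b)"
  have "(\<Sum>i\<in>UNIV. \<Sum>j\<in>UNIV. a $ i * A $ i $ j * b $ j) = a \<bullet> y"
    by (simp add: y_def inner_vec_def sum_distrib_left mult.assoc)
  also have "\<bar>\<dots>\<bar> \<le> norm a * norm y"
    by (rule Cauchy_Schwarz_ineq2)
  also have "norm y \<le> L2_set (\<lambda>i. norm (A $ i) * norm b) UNIV"
    unfolding norm_vec_def[of y] by (intro L2_set_mono) (simp_all add: y_def Cauchy_Schwarz_ineq2)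
  also have "\<dots> = norm A * norm b"
    by (simp add: norm_vec_def[of A] L2_set_left_distrib)
  finally show ?thesis
    by (simp add: mult_left_mono mult.assoc)
qed

text \<open>Integrability is part of the conclusion because the integral of a non-integrable
  function is 0 by convention, and the estimate would then say nothing. The supremum is taken in
  \<open>ereal\<close> so that it is meaningful for an unbounded family as well.\<close>

theorem lemma6:
  fixes B \<Omega> :: "(real^2) set" and \<epsilon> \<delta> :: real and u :: "real^2 \<Rightarrow> real^2"
  assumes "bounded B" and "simply_connected B" and "lipschitz_domain B" and "0 \<in> B"
    and "\<Omega> = - closure B"
    and "\<epsilon> > 0" and "ball 0 \<epsilon> \<inter> \<Omega> = {}"
    and "u \<in> borel_measurable (lebesgue_on \<Omega>)"
    and "\<delta> > 0"
    and "(SUP x\<in>\<Omega>. ereal (norm x * ln (norm x / \<epsilon>) * norm (u x))) \<le> ereal (\<delta> / 2)"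
  shows "\<forall>v\<in>H1dot_0_sigma \<Omega>.
     integrable (lebesgue_on \<Omega>) (convection_density \<Omega> v u) \<and>
     \<bar>\<integral>x. convection_density \<Omega> v u x \<partial>lebesgue_on \<Omega>\<bar> \<le> \<delta> * (L2_norm \<Omega> (weak_gradient \<Omega> v))\<^sup>2"
proof
  fix v assume v: "v \<in> H1dot_0_sigma \<Omega>"
  define G where "G = weak_gradient \<Omega> v"
  define V where "V x = hardy_weight \<epsilon> x *\<^sub>R v x" for x
  have "open \<Omega>"
    using assms(5) by auto
  \<comment> \<open>Being open, \<open>\<Omega>\<close> misses the closed ball as soon as it misses
    the open one; hence |x| > \<epsilon> strictly, and the logarithm is positive on all of
    \<open>\<Omega>\<close>.\<close>
  have "\<Omega> \<inter> closure (ball 0 \<epsilon>) = {}"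
    using open_Int_closure_eq_empty[OF \<open>open \<Omega>\<close>, of "ball 0 \<epsilon>"] assms(7) by (simp add: Int_commute)
  then have \<Omega>: "\<Omega> \<subseteq> - cball 0 \<epsilon>"
    using \<open>\<epsilon> > 0\<close> by auto
  have Hardy: "V \<in> L2 \<Omega>" "L2_norm \<Omega> V \<le> 2 * L2_norm \<Omega> G"
    using Hardy_inequality_H1dot_0_sigma[OF \<open>open \<Omega>\<close> \<open>\<epsilon> > 0\<close> \<Omega> v]
    by (simp_all add: V_def[abs_def] G_def)
  have G: "G \<in> L2 \<Omega>"
    using v by (simp add: H1dot_0_sigma_def G_def)
  have meas: "v \<in> borel_measurable (lebesgue_on \<Omega>)" "G \<in> borel_measurable (lebesgue_on \<Omega>)"
    using v G by (auto simp: H1dot_0_sigma_def has_weak_gradient_def locally_L1_def L2_def)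
  have nth: "(\<lambda>x. f x $ i) \<in> borel_measurable M" if "f \<in> borel_measurable M"
    for M :: "(real^2) measure" and f :: "real^2 \<Rightarrow> 'c::euclidean_space^2" and i
    by (rule borel_measurable_continuous_on[OF _ that]) (intro continuous_intros)
  have conv_meas: "convection_density \<Omega> v u \<in> borel_measurable (lebesgue_on \<Omega>)"
    unfolding convection_density_def[abs_def] G_def[symmetric]
    by (intro borel_measurable_sum borel_measurable_times nth meas assms(8))
  have bound: "\<bar>convection_density \<Omega> v u x\<bar> \<le> \<delta> / 2 * (norm (V x) * norm (G x))" if "x \<in> \<Omega>" for x
  proof -
    have "\<epsilon> < norm x"
      using that \<Omega> by auto
    have "0 < ln (norm x / \<epsilon>)" "0 < norm x"
      using \<open>\<epsilon> < norm x\<close> \<open>\<epsilon> > 0\<close> by (auto intro!: ln_gt_zero)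
    then have pos: "0 < norm x * ln (norm x / \<epsilon>)"
      by (rule mult_pos_pos[rotated])
    have "ereal (norm x * ln (norm x / \<epsilon>) * norm (u x)) \<le> ereal (\<delta> / 2)"
      using assms(10) that by (rule order_trans[OF SUP_upper, rotated])
    then have u: "norm (u x) \<le> \<delta> / 2 * hardy_weight \<epsilon> x"
      using pos by (simp add: hardy_weight_def pos_le_divide_eq mult.commute)
    have "\<bar>convection_density \<Omega> v u x\<bar> \<le> norm (v x) * norm (G x) * norm (u x)"
      unfolding convection_density_def G_def by (rule abs_bilinear_form_le)
    also have "\<dots> \<le> norm (v x) * norm (G x) * (\<delta> / 2 * hardy_weight \<epsilon> x)"
      by (intro mult_left_mono u) simp
    \<comment> \<open>The weight that bounds \<open>u\<close> is passed on to \<open>v\<close>; it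
      is positive at \<open>x\<close>, so it can be drawn into the norm.\<close>
    also have "\<dots> = \<delta> / 2 * (norm (V x) * norm (G x))"
      using pos by (simp add: V_def hardy_weight_def)
    finally show ?thesis .
  qed
  have int: "integrable (lebesgue_on \<Omega>) (\<lambda>x. \<delta> / 2 * (norm (V x) * norm (G x)))"
    using integrable_L2_product[OF Hardy(1) G] by simp
  have conv_int: "integrable (lebesgue_on \<Omega>) (convection_density \<Omega> v u)"
    by (rule Bochner_Integration.integrable_bound[OF int conv_meas], rule AE_I2)
      (use bound \<open>\<delta> > 0\<close> in \<open>auto simp: abs_mult space_restrict_space\<close>)
  have "\<bar>\<integral>x. convection_density \<Omega> v u x \<partial>lebesgue_on \<Omega>\<bar>
      \<le> (\<integral>x. \<delta> / 2 * (norm (V x) * norm (G x)) \<partial>lebesgue_on \<Omega>)"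
    using Bochner_Integration.integral_norm_bound_integral[OF conv_int int] bound by (simp add: space_restrict_space)
  also have "\<dots> = \<delta> / 2 * (\<integral>x. norm (V x) * norm (G x) \<partial>lebesgue_on \<Omega>)"
    by (rule integral_mult_right_zero)
  \<comment> \<open>The Hardy constant 2 is exactly what the factor 1/2 in the hypothesis on
    \<open>u\<close> compensates.\<close>
  also have "\<dots> \<le> \<delta> / 2 * (2 * L2_norm \<Omega> G * L2_norm \<Omega> G)"
    using \<open>\<delta> > 0\<close> order_trans[OF L2_norm_Cauchy_Schwarz[OF Hardy(1) G] mult_right_mono[OF Hardy(2) L2_norm_nonneg]]
    by (intro mult_left_mono) auto
  also have "\<dots> = \<delta> * (L2_norm \<Omega> G)\<^sup>2"
    by (simp add: power2_eq_square)
  finally show "integrable (lebesgue_on \<Omega>) (convection_density \<Omega> v u) \<and>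
     \<bar>\<integral>x. convection_density \<Omega> v u x \<partial>lebesgue_on \<Omega>\<bar> \<le> \<delta> * (L2_norm \<Omega> (weak_gradient \<Omega> v))\<^sup>2"
    using conv_int by (simp add: G_def)
qed

end
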